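(* Let $A$ be a finite set of odd order and let $o\in A$ be arbitrary. Then every bijection in $B(A)$ is isomorphically realised by $$T_2=\{TG(i,\alpha,o)\mid \alpha\in S_A,\ i<3\}=S_A\cup\{TG(2,\alpha,o)\mid \alpha\in S_A\},$$ that is, $B(A)\subseteq C(T_2)$.
   Context: $\mathbb N=\{1,2,3,\dots\}$. For a nonempty set $A$ and $n,m\in\mathbb N$, $M_{n,m}(A)$ is the set of all maps $f:A^n\to A^m$ (arity $n$, co-arity $m$), $M(A)=\bigcup_{n,m}M_{n,m}(A)$, and $f=(f_1,\dots,f_m)$ in components. $S_A$ is the set of permutations of $A$. For finite $A$, $B_n(A)$ is the set of bijections $A^n\to A^n$ and $B(A)=\bigcup_{n\in\mathbb N}B_n(A)$. Operations on $M(A)$, for $f\in M_{n,s}(A)$, $g\in M_{m,t}(A)$: - $i_1:A\to A$ is the identity (a constant, i.e. nullary operation); - $f\oplus g\in M_{n+m,s+t}(A)$, $(f\oplus g)(x_1,\dots,x_{n+m})=(f_1(x_1,\dots,x_n),\dots,f_s(x_1,\dots,x_n),g_1(x_{n+1},\dots,x_{n+m}),\dots,g_t(x_{n+1},\dots,x_{n+m}))$; - for $k\in\mathbb N$ with $k\le n$ and $k\le t$ (otherwise undefined), $f\circ_k g\in M_{n+m-k,s+t-k}(A)$ has $j$-th component, for $j\le s$, $f_j(g_1(x_1,\dots,x_m),\dots,g_k(x_1,\dots,x_m),x_{m+1},\dots,x_{m+n-k})$, and, for $s<j\le s+t-k$, $g_{k+j-s}(x_1,\dots,x_m)$; - $(\tau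 f)(x_1,\dots,x_n)=f(x_2,x_1,x_3,\dots,x_n)$, $(\zeta f)(x_1,\dots,x_n)=f(x_2,\dots,x_n,x_1)$, with $\tau f=\zeta f=f$ if $n=1$. A Toffoli algebra on $A$ is a subset of $M(A)$ containing $i_1$ and closed under $\oplus,\tau,\zeta$ and all partial operations $\circ_k$, $k\in\mathbb N$. For $F\subseteq M(A)$, $C(F)$ is the smallest Toffoli algebra containing $F$. A mapping $g$ is isomorphically realised by $F$ if $g\in C(F)$. Toffoli gates: for $\alpha\in S_A$, $o\in A$, $TG(1,\alpha,o)=\alpha$, and for $n\ge2$, $TG(n,\alpha,o)\in B_n(A)$ sends $(x_1,\dots,x_n)$ to $(x_1,\dots,x_{n-1},\alpha(x_n))$ if $x_1=\dots=x_{n-1}=o$, and fixes $(x_1,\dots,x_n)$ otherwise. *)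

theory Defs
  imports "HOL-Combinatorics.Permutations" "HOL-Library.FuncSet"
begin

definition tuples :: "'a set \<Rightarrow> nat \<Rightarrow> 'a list set" where
  "tuples A n = {xs. set xs \<subseteq> A \<and> length xs = n}"

text \<open>
  A map \<open>A\<^sup>n \<rightarrow> A\<^sup>m\<close> is a triple of its arity \<open>n\<close>, its co-arity \<open>m\<close> and a function on lists
  that is \<open>undefined\<close> off \<open>tuples A n\<close>, so that equality of triples is equality of maps.
\<close>

type_synonym 'a mapping = "nat \<times> nat \<times> ('a list \<Rightarrow> 'a list)"

definition maps :: "'a set \<Rightarrow> 'a mapping set" where
  "maps A = {(n, m, f). 1 \<le> n \<and> 1 \<le> m \<and> f \<in> tuples A n \<rightarrow>\<^sub>E tuples A m}"

definition bijections :: "'a set \<Rightarrow> 'a mapping set" where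
  "bijections A = {(n, m, f). 1 \<le> n \<and> m = n \<and> f \<in> extensional (tuples A n) \<and>
                              bij_betw f (tuples A n) (tuples A n)}"

definition identity :: "'a set \<Rightarrow> 'a mapping" where
  "identity A = (1, 1, \<lambda>xs\<in>tuples A 1. xs)"

fun oplus :: "'a set \<Rightarrow> 'a mapping \<Rightarrow> 'a mapping \<Rightarrow> 'a mapping" where
  "oplus A (n, s, f) (m, t, g) =
     (n + m, s + t, \<lambda>xs\<in>tuples A (n + m). f (take n xs) @ g (drop n xs))"

text \<open>
  The partial operation \<open>f \<circ>\<^sub>k g\<close>; it is meaningful only for \<open>1 \<le> k\<close>, \<open>k \<le> n\<close> and \<open>k \<le> t\<close>,
  and is only used under these conditions below.
\<close>

fun compose_at :: "'a set \<Rightarrow> nat \<Rightarrow> 'a mapping \<Rightarrow> 'a mapping \<Rightarrow> 'a mapping" where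
  "compose_at A k (n, s, f) (m, t, g) =
     (n + m - k, s + t - k,
      \<lambda>xs\<in>tuples A (n + m - k).
        let ys = g (take m xs) in f (take k ys @ drop m xs) @ drop k ys)"

fun swap_first :: "'a list \<Rightarrow> 'a list" where
  "swap_first (x # y # xs) = y # x # xs"
| "swap_first xs = xs"

fun tau :: "'a set \<Rightarrow> 'a mapping \<Rightarrow> 'a mapping" where
  "tau A (n, s, f) = (n, s, \<lambda>xs\<in>tuples A n. f (swap_first xs))"

fun zeta :: "'a set \<Rightarrow> 'a mapping \<Rightarrow> 'a mapping" where
  "zeta A (n, s, f) = (n, s, \<lambda>xs\<in>tuples A n. f (rotate1 xs))"

definition arity :: "'a mapping \<Rightarrow> nat" where
  "arity f = fst f"

definition coarity :: "'a mapping \<Rightarrow> nat" where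
  "coarity f = fst (snd f)"

definition toffoli_algebra :: "'a set \<Rightarrow> 'a mapping set \<Rightarrow> bool" where
  "toffoli_algebra A T \<longleftrightarrow>
     T \<subseteq> maps A \<and>
     identity A \<in> T \<and>
     (\<forall>f\<in>T. \<forall>g\<in>T. oplus A f g \<in> T) \<and>
     (\<forall>f\<in>T. tau A f \<in> T) \<and>
     (\<forall>f\<in>T. zeta A f \<in> T) \<and>
     (\<forall>f\<in>T. \<forall>g\<in>T. \<forall>k. 1 \<le> k \<and> k \<le> arity f \<and> k \<le> coarity g \<longrightarrow> compose_at A k f g \<in> T)"

text \<open>
  The intersection is the smallest Toffoli algebra containing \<open>F\<close> provided \<open>F \<subseteq> maps A\<close>
  (see \<open>toffoli_algebra_closure\<close>); otherwise the intersected family is empty.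
\<close>

definition toffoli_closure :: "'a set \<Rightarrow> 'a mapping set \<Rightarrow> 'a mapping set" where
  "toffoli_closure A F = \<Inter>{T. toffoli_algebra A T \<and> F \<subseteq> T}"

definition unary :: "'a set \<Rightarrow> ('a \<Rightarrow> 'a) \<Rightarrow> 'a mapping" where
  "unary A \<alpha> = (1, 1, \<lambda>xs\<in>tuples A 1. map \<alpha> xs)"

definition TG :: "'a set \<Rightarrow> nat \<Rightarrow> ('a \<Rightarrow> 'a) \<Rightarrow> 'a \<Rightarrow> 'a mapping" where
  "TG A n \<alpha> c =
     (if n = 1 then unary A \<alpha>
      else (n, n, \<lambda>xs\<in>tuples A n.
                    if \<forall>x\<in>set (butlast xs). x = c then butlast xs @ [\<alpha> (last xs)] else xs))"

definition T2 :: "'a set \<Rightarrow> 'a \<Rightarrow> 'a mapping set" where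
  "T2 A c = {TG A i \<alpha> c | i \<alpha>. \<alpha> permutes A \<and> 1 \<le> i \<and> i < 3}"

lemma T2_eq:
  "T2 A c = {unary A \<alpha> | \<alpha>. \<alpha> permutes A} \<union> {TG A 2 \<alpha> c | \<alpha>. \<alpha> permutes A}"
proof -
  have "1 \<le> i \<and> i < 3 \<longleftrightarrow> i = 1 \<or> i = 2" for i :: nat
    by auto
  then have "x \<in> T2 A c \<longleftrightarrow>
      (\<exists>\<alpha>. x = TG A 1 \<alpha> c \<and> \<alpha> permutes A) \<or> (\<exists>\<alpha>. x = TG A 2 \<alpha> c \<and> \<alpha> permutes A)" for x
    unfolding T2_def mem_Collect_eq by metis
  moreover have "TG A 1 \<alpha> c = unary A \<alpha>" for \<alpha>
    by (simp add: TG_def)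
  ultimately show ?thesis
    by (intro set_eqI) (simp only: Un_iff mem_Collect_eq)
qed

lemma toffoli_algebra_maps: "toffoli_algebra A (maps A)"
proof -
  have sw: "swap_first xs \<in> tuples A n" if "xs \<in> tuples A n" for xs n
    using that by (cases xs rule: swap_first.cases) (auto simp: tuples_def)
  have ro: "rotate1 xs \<in> tuples A n" if "xs \<in> tuples A n" for xs n
    using that by (auto simp: tuples_def)
  have tk: "take i xs \<in> tuples A i" "drop i xs \<in> tuples A (n - i)"
    if "xs \<in> tuples A n" "i \<le> n" for xs n i
    using that by (auto simp: tuples_def dest: in_set_takeD in_set_dropD)
  have ap: "xs @ ys \<in> tuples A l"
    if "xs \<in> tuples A n" "ys \<in> tuples A m" "l = n + m" for xs ys n m l
    using that by (auto simp: tuples_def)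
  have op: "oplus A f g \<in> maps A" if "f \<in> maps A" "g \<in> maps A" for f g
  proof -
    obtain n s f' m t g' where fg: "f = (n, s, f')" "g = (m, t, g')"
      by (metis prod_cases3)
    have "f' (take n xs) @ g' (drop n xs) \<in> tuples A (s + t)" if xs: "xs \<in> tuples A (n + m)" for xs
    proof -
      have "take n xs \<in> tuples A n" "drop n xs \<in> tuples A m"
        using tk[OF xs, of n] by auto
      then show ?thesis
        using \<open>f \<in> maps A\<close> \<open>g \<in> maps A\<close> unfolding fg maps_def by (auto intro!: ap)
    qed
    then show ?thesis
      using that unfolding fg maps_def by auto
  qed
  have co: "compose_at A k f g \<in> maps A"
    if f: "f \<in> maps A" and g: "g \<in> maps A" and k: "1 \<le> k" "k \<le> arity f" "k \<le> coarity g" for f g k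
  proof -
    obtain n s f' m t g' where fg: "f = (n, s, f')" "g = (m, t, g')"
      by (metis prod_cases3)
    have kn: "k \<le> n" "k \<le> t"
      using k by (auto simp: fg arity_def coarity_def)
    have F: "f' ys \<in> tuples A s" if "ys \<in> tuples A n" for ys
      using f that unfolding fg maps_def by auto
    have G: "g' ys \<in> tuples A t" if "ys \<in> tuples A m" for ys
      using g that unfolding fg maps_def by auto
    have "f' (take k (g' (take m xs)) @ drop m xs) @ drop k (g' (take m xs)) \<in> tuples A (s + t - k)"
      if xs: "xs \<in> tuples A (n + m - k)" for xs
    proof -
      have m: "m \<le> n + m - k"
        using kn by simp
      note y = G[OF tk(1)[OF xs m]]
      show ?thesis
        by (rule ap[OF F[OF ap[OF tk(1)[OF y kn(2)] tk(2)[OF xs m]]] tk(2)[OF y kn(2)]])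
           (use kn in auto)
    qed
    then show ?thesis
      using f g kn unfolding fg maps_def by (auto simp: Let_def)
  qed
  have "identity A \<in> maps A"
    by (simp add: identity_def maps_def PiE_iff)
  moreover have "tau A f \<in> maps A" "zeta A f \<in> maps A" if f: "f \<in> maps A" for f
    using f by (cases f; auto simp: maps_def PiE_iff sw ro)+
  ultimately show ?thesis
    unfolding toffoli_algebra_def by (intro conjI ballI allI impI) (auto intro: op co)
qed

lemma T2_subset_maps:
  assumes "c \<in> A"
  shows "T2 A c \<subseteq> maps A"
proof -
  have "TG A 2 \<alpha> c \<in> maps A" if p: "\<alpha> permutes A" for \<alpha>
  proof -
    have "butlast xs @ [\<alpha> (last xs)] \<in> tuples A 2" if xs: "xs \<in> tuples A 2" for xs
    proof -
      from xs obtain x y where "xs = [x, y]" "x \<in> A" "y \<in> A"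
        by (auto simp: tuples_def length_Suc_conv numeral_2_eq_2)
      then show ?thesis
        using permutes_in_image[OF p] by (simp add: tuples_def)
    qed
    then show ?thesis
      by (simp add: TG_def maps_def PiE_iff)
  qed
  moreover have "unary A \<alpha> \<in> maps A" if p: "\<alpha> permutes A" for \<alpha>
  proof -
    have "map \<alpha> xs \<in> tuples A 1" if "xs \<in> tuples A 1" for xs
      using that permutes_in_image[OF p] by (auto simp: tuples_def)
    then show ?thesis
      by (simp add: unary_def maps_def PiE_iff)
  qed
  ultimately show ?thesis
    unfolding T2_eq by (intro Un_least subsetI) (elim CollectE exE conjE, simp)+
qed

lemma toffoli_algebra_closure:
  assumes "F \<subseteq> maps A"
  shows "toffoli_algebra A (toffoli_closure A F)" "F \<subseteq> toffoli_closure A F"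
    and "\<And>T. toffoli_algebra A T \<Longrightarrow> F \<subseteq> T \<Longrightarrow> toffoli_closure A F \<subseteq> T"
proof -
  let ?C = "toffoli_closure A F"
  have sub: "toffoli_algebra A T \<Longrightarrow> F \<subseteq> T \<Longrightarrow> ?C \<subseteq> T" for T
    unfolding toffoli_closure_def by blast
  have into: "x \<in> ?C" if "\<And>T. toffoli_algebra A T \<Longrightarrow> F \<subseteq> T \<Longrightarrow> x \<in> T" for x
    using that unfolding toffoli_closure_def by blast
  have "?C \<subseteq> maps A"
    by (rule sub[OF toffoli_algebra_maps assms])
  moreover have "identity A \<in> ?C"
    by (rule into) (simp add: toffoli_algebra_def)
  moreover have "oplus A f g \<in> ?C" if "f \<in> ?C" "g \<in> ?C" for f g
  proof (rule into)
    fix T assume T: "toffoli_algebra A T" "F \<subseteq> T"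
    have "f \<in> T" "g \<in> T"
      using subsetD[OF sub[OF T]] that(1,2) by simp_all
    with T(1) show "oplus A f g \<in> T" by (simp add: toffoli_algebra_def)
  qed
  moreover have "tau A f \<in> ?C" "zeta A f \<in> ?C" if f: "f \<in> ?C" for f
  proof -
    have "tau A f \<in> T \<and> zeta A f \<in> T" if T: "toffoli_algebra A T" "F \<subseteq> T" for T
    proof -
      have "f \<in> T"
        using subsetD[OF sub[OF T] f] .
      with T(1) show ?thesis by (simp add: toffoli_algebra_def)
    qed
    then show "tau A f \<in> ?C" "zeta A f \<in> ?C" by (simp_all add: into)
  qed
  moreover have "compose_at A k f g \<in> ?C"
    if "f \<in> ?C" "g \<in> ?C" and k: "1 \<le> k" "k \<le> arity f" "k \<le> coarity g" for f g k
  proof (rule into)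
    fix T assume T: "toffoli_algebra A T" "F \<subseteq> T"
    have "f \<in> T" "g \<in> T"
      using subsetD[OF sub[OF T]] that(1,2) by simp_all
    with T(1) k show "compose_at A k f g \<in> T" by (simp add: toffoli_algebra_def)
  qed
  ultimately show "toffoli_algebra A ?C"
    unfolding toffoli_algebra_def[of A ?C] by (intro conjI ballI allI impI; simp)
  show "F \<subseteq> ?C" unfolding toffoli_closure_def by blast
  show "\<And>T. toffoli_algebra A T \<Longrightarrow> F \<subseteq> T \<Longrightarrow> ?C \<subseteq> T" by (fact sub)
qed

end

theory Submission
  imports Defs
begin

text \<open>
  Fix a Toffoli algebra \<open>T\<close> containing the gates. The maps \<open>A\<^sup>n \<rightarrow> A\<^sup>n\<close> in \<open>T\<close> are closed under
  composition, and \<open>\<oplus>\<close> makes a map on some adjacent coordinates act on a longer tuple. So it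
  suffices to realise every transposition of two points of \<open>A\<^sup>n\<close>; for \<open>n = 1\<close> these are unary
  gates, and from \<open>n = 2\<close> on the proof is by induction on \<open>n\<close>.

  For \<open>n = 2\<close>, the controlled gate of the transposition of \<open>x\<close> and \<open>y\<close> moves only \<open>(c, x)\<close> and
  \<open>(c, y)\<close>, so it is itself a transposition of \<open>A\<^sup>2\<close>. Conjugating it with unary permutations and
  with the exchange of the two wires gives all transpositions along a row or a column, and these
  generate the others (\<open>transpositions_of_pairs\<close>).

  For the step to \<open>n + 1 \<ge> 3\<close>, a transposition on the first \<open>n\<close> coordinates acts on \<open>A\<^sup>n\<^sup>+\<^sup>1\<close> as a
  product of \<open>|A|\<close> disjoint transpositions. When its support meets that of a transposition on the
  last two coordinates in a single point, the commutator of the two is a three-cycle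
  (\<open>three_cycle_of_tuples\<close>). As \<open>|A| \<ge> 3\<close>, these three-cycles connect all points of \<open>A\<^sup>n\<^sup>+\<^sup>1\<close>, hence
  generate all products of two transpositions (\<open>pair_of_transpositions\<close>), that is, the
  alternating group. As \<open>|A|\<close> is odd, the product of \<open>|A|\<close> transpositions is an odd permutation,
  and together with the alternating group it yields every single transposition
  (\<open>transpositions_step\<close>). For even \<open>|A|\<close> this last argument breaks down, since every gate on
  two coordinates is then even on \<open>A\<^sup>3\<close>.

  If \<open>|A| = 1\<close>, there is nothing to transpose.
\<close>

section \<open>Permutations generated by transpositions and three-cycles\<close>

lemma transpositions_generate:
  assumes fin: "finite \<Omega>" and comp: "\<forall>f\<in>G. \<forall>g\<in>G. f \<circ> g \<in> G" and id: "id \<in> G"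
    and swap: "\<And>x y. x \<in> \<Omega> \<Longrightarrow> y \<in> \<Omega> \<Longrightarrow> x \<noteq> y \<Longrightarrow> transpose x y \<in> G"
    and p: "p permutes \<Omega>"
  shows "p \<in> G"
  using p fin
proof (induction rule: permutes_induct)
  case id
  then show ?case by (fact assms(3))
next
  case (swap a b p)
  then show ?case using comp assms(4) by blast
qed

text \<open>
  The composition below is the three-cycle \<open>x \<mapsto> y \<mapsto> z \<mapsto> x\<close>. Membership is invariant under all
  permutations of the three points as soon as \<open>G\<close> is closed under composition, because the
  inverse of a three-cycle is its square.
\<close>

definition has_three_cycle :: "('b \<Rightarrow> 'b) set \<Rightarrow> 'b \<Rightarrow> 'b \<Rightarrow> 'b \<Rightarrow> bool" where
  "has_three_cycle G x y z \<longleftrightarrow>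
     x \<noteq> y \<and> y \<noteq> z \<and> x \<noteq> z \<and> transpose x y \<circ> transpose y z \<in> G"

lemma three_cycle_rotate:
  assumes "has_three_cycle G x y z"
  shows "has_three_cycle G y z x"
proof -
  have "transpose x y \<circ> transpose y z = transpose y z \<circ> transpose z x"
    using assms by (auto simp: has_three_cycle_def fun_eq_iff transpose_def)
  then show ?thesis
    using assms by (auto simp: has_three_cycle_def)
qed

lemma three_cycle_reverse:
  assumes comp: "\<forall>f\<in>G. \<forall>g\<in>G. f \<circ> g \<in> G"
    and "has_three_cycle G x y z"
  shows "has_three_cycle G z y x"
proof -
  let ?c = "transpose x y \<circ> transpose y z"
  have "transpose z y \<circ> transpose y x = ?c \<circ> ?c"
    using assms by (auto simp: has_three_cycle_def fun_eq_iff transpose_def)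
  then show ?thesis
    using assms by (auto simp: has_three_cycle_def)
qed

text \<open>
  Conjugating the cycle on \<open>x, y, z\<close> by the one on \<open>x, w, v\<close>, or by
  its inverse, replaces \<open>x\<close> by \<open>w\<close>. This is the one step from which connectedness yields all three-cycles.
\<close>

lemma three_cycle_exchange:
  assumes comp: "\<forall>f\<in>G. \<forall>g\<in>G. f \<circ> g \<in> G"
    and xyz: "has_three_cycle G x y z" and xwv: "has_three_cycle G x w v"
    and w: "w \<noteq> y" "w \<noteq> z"
  shows "has_three_cycle G w y z"
proof -
  note rev = three_cycle_reverse[OF comp]
  let ?s = "transpose x w \<circ> transpose w v" and ?s' = "transpose v w \<circ> transpose w x"
  let ?c = "transpose x y \<circ> transpose y z"
  have d: "x \<noteq> y" "y \<noteq> z" "x \<noteq> z" "x \<noteq> w" "w \<noteq> v" "x \<noteq> v"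
    using xyz xwv by (auto simp: has_three_cycle_def)
  have G: "?s \<in> G" "?s' \<in> G" "?c \<in> G"
    using xyz xwv rev[OF xwv] by (auto simp: has_three_cycle_def)
  show ?thesis
  proof (cases "v = y \<or> v = z")
    case True
    \<comment> \<open>conjugating by \<open>?s\<close> would move \<open>y\<close> or \<open>z\<close>
      to \<open>x\<close>; its inverse keeps the support inside \<open>{w, y, z}\<close>\<close>
    have "transpose z y \<circ> transpose y w = ?s' \<circ> ?c \<circ> ?s"
    proof
      fix t
      consider "t = x" | "t = y" | "t = z" | "t = w" | "t = v" | "t \<notin> {x, y, z, w, v}"
        by blast
      then show "(transpose z y \<circ> transpose y w) t = (?s' \<circ> ?c \<circ> ?s) t"
        using d w True by cases (auto simp: transpose_def)
    qed
    then have "has_three_cycle G z y w"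
      using comp G d w by (auto simp: has_three_cycle_def)
    then show ?thesis by (rule rev)
  next
    case False
    have "transpose w y \<circ> transpose y z = ?s \<circ> ?c \<circ> ?s'"
    proof
      fix t
      consider "t = x" | "t = y" | "t = z" | "t = w" | "t = v" | "t \<notin> {x, y, z, w, v}"
        by blast
      then show "(transpose w y \<circ> transpose y z) t = (?s \<circ> ?c \<circ> ?s') t"
        using d w False by cases (auto simp: transpose_def)
    qed
    then show ?thesis using comp G d w
      by (simp add: has_three_cycle_def)
  qed
qed

text \<open>
  Lying on a common three-cycle is a transitive relation, and within a class of linked points all
  three-cycles are present.
\<close>

definition three_linked :: "('b \<Rightarrow> 'b) set \<Rightarrow> 'b \<Rightarrow> 'b \<Rightarrow> bool" where
  "three_linked G x y \<longleftrightarrow> (\<exists>z. has_three_cycle G x y z)"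

lemma three_linked_trans:
  assumes comp: "\<forall>f\<in>G. \<forall>g\<in>G. f \<circ> g \<in> G"
    and xy: "three_linked G x y" and yw: "three_linked G y w" and "x \<noteq> w"
  shows "three_linked G x w"
proof -
  note rot = three_cycle_rotate and rev = three_cycle_reverse[OF comp]
  from xy yw obtain z v where z: "has_three_cycle G x y z" and v: "has_three_cycle G y w v"
    by (auto simp: three_linked_def)
  show ?thesis
  proof (cases "w = z")
    case True
    then show ?thesis
      using rot[OF rot[OF rev[OF z]]] by (auto simp: three_linked_def)
  next
    case False
    have "has_three_cycle G w z x"
      using three_cycle_exchange[OF comp rot[OF z] v] False \<open>x \<noteq> w\<close> by blast
    then show ?thesis
      using rot[of G w z x] rot[of G z x w] by (auto simp: three_linked_def)
  qed
qed

lemma three_linked_cycle: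
  assumes comp: "\<forall>f\<in>G. \<forall>g\<in>G. f \<circ> g \<in> G"
    and xy: "three_linked G x y" and yz: "three_linked G y z" and "x \<noteq> z"
  shows "has_three_cycle G x y z"
proof -
  note rot = three_cycle_rotate and rev = three_cycle_reverse[OF comp]
  from xy yz obtain v u where v: "has_three_cycle G x y v" and u: "has_three_cycle G y z u"
    by (auto simp: three_linked_def)
  show ?thesis
  proof (cases "v = z")
    case True
    then show ?thesis using v by simp
  next
    case False
    have *: "has_three_cycle G z v x"
      using three_cycle_exchange[OF comp rot[OF v] u] False \<open>x \<noteq> z\<close> by blast
    have "y \<noteq> x" "y \<noteq> z" using v u by (auto simp: has_three_cycle_def)
    then have "has_three_cycle G y x z"
      using three_cycle_exchange[OF comp rot[OF *] rev[OF v]] by blast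
    then show ?thesis by (rule rot[OF rev])
  qed
qed

text \<open>
  Two transpositions sharing a point compose to a three-cycle or to the identity; two others are
  joined by inserting the square of a transposition that meets both.
\<close>

lemma pair_of_transpositions:
  assumes comp: "\<forall>f\<in>G. \<forall>g\<in>G. f \<circ> g \<in> G" and id: "id \<in> G"
    and linked: "\<forall>x\<in>\<Omega>. \<forall>y\<in>\<Omega>. x \<noteq> y \<longrightarrow> three_linked G x y"
    and \<Omega>: "x \<in> \<Omega>" "y \<in> \<Omega>" "z \<in> \<Omega>" "w \<in> \<Omega>" and d: "x \<noteq> y" "z \<noteq> w"
  shows "transpose x y \<circ> transpose z w \<in> G"
proof -
  have adj: "transpose a b \<circ> transpose b e \<in> G"
    if "a \<in> \<Omega>" "b \<in> \<Omega>" "e \<in> \<Omega>" "a \<noteq> b" "b \<noteq> e" for a b e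
  proof (cases "a = e")
    case True
    then have "transpose a b \<circ> transpose b e = id"
      by (simp add: transpose_commute)
    then show ?thesis using id by simp
  next
    case False
    then show ?thesis
      using three_linked_cycle[OF comp, of a b e] linked that
      by (simp add: has_three_cycle_def)
  qed
  show ?thesis
  proof (cases "y = z")
    case True
    then show ?thesis using adj \<Omega> d by simp
  next
    case False
    have eq: "transpose x y \<circ> transpose z w
        = (transpose x y \<circ> transpose y z) \<circ> (transpose y z \<circ> transpose z w)"
      by (simp add: fun_eq_iff)
    show ?thesis
      unfolding eq
      by (rule bspec[OF bspec[OF comp]]; rule adj) (use \<Omega> d False in auto)
  qed
qed

text \<open>
  If the supports of two involutions \<open>a\<close> and \<open>b\<close> meet only in \<open>p\<close>, then \<open>b\<close> fixes \<open>a p\<close> and \<open>a\<close>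
  fixes \<open>b p\<close>, and away from \<open>p\<close> and these two points \<open>a\<close> and \<open>b\<close> cancel out in their commutator.
\<close>

lemma commutator_three_cycle:
  assumes a: "\<And>x. x \<in> \<Omega> \<Longrightarrow> a x \<in> \<Omega> \<and> a (a x) = x"
    and b: "\<And>x. x \<in> \<Omega> \<Longrightarrow> b x \<in> \<Omega> \<and> b (b x) = x"
    and supp: "\<And>x. x \<in> \<Omega> \<Longrightarrow> a x \<noteq> x \<Longrightarrow> b x \<noteq> x \<Longrightarrow> x = p"
    and p: "p \<in> \<Omega>" "a p \<noteq> p" "b p \<noteq> p"
    and x: "x \<in> \<Omega>"
  shows "a (b (a (b x))) = transpose p (a p) (transpose (a p) (b p) x)"
proof -
  note aa = conjunct2[OF a] and bb = conjunct2[OF b]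
  have fixed: "b (a x) = a x" if "x \<in> \<Omega>" "a x \<noteq> x" "a x \<noteq> p" for x
  proof (rule ccontr)
    assume "b (a x) \<noteq> a x"
    moreover have "a (a x) \<noteq> a x" using aa[OF that(1)] that(2) by simp
    ultimately show False using supp[of "a x"] a[OF that(1)] that(3) by blast
  qed
  have fixed': "a (b x) = b x" if "x \<in> \<Omega>" "b x \<noteq> x" "b x \<noteq> p" for x
  proof (rule ccontr)
    assume "a (b x) \<noteq> b x"
    moreover have "b (b x) \<noteq> b x" using bb[OF that(1)] that(2) by simp
    ultimately show False using supp[of "b x"] b[OF that(1)] that(3) by blast
  qed
  have bap: "b (a p) = a p" and abp: "a (b p) = b p"
    using fixed[OF p(1,2,2)] fixed'[OF p(1,3,3)] .
  have ab: "a p \<noteq> b p"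
  proof
    assume "a p = b p"
    with abp have "a (a p) = a p" by simp
    with aa[OF p(1)] p(2) show False by simp
  qed
  note pq = bap abp ab p(2,3) aa[OF p(1)] bb[OF p(1)]
  consider "x = p" | "x = a p" | "x = b p" | "x \<noteq> p" "x \<noteq> a p" "x \<noteq> b p"
    by blast
  then show ?thesis
  proof cases
    case 4
    have "a (b (a (b x))) = x"
    proof (cases "b x = x")
      case True
      have "a x \<noteq> p" using aa[OF x] 4(2) by auto
      then have "b (a x) = a x" using fixed[OF x] True by (cases "a x = x") simp_all
      then show ?thesis using True aa[OF x] by simp
    next
      case False
      have "b x \<noteq> p" using bb[OF x] 4(3) by auto
      then have "a (b x) = b x" using fixed'[OF x False] by simp
      moreover have "a x = x" using supp[OF x _ False] 4(1) by blast
      ultimately show ?thesis using bb[OF x] by simp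
    qed
    then show ?thesis using 4 by (simp add: transpose_def)
  qed (use pq in \<open>simp_all add: transpose_def\<close>)
qed

section \<open>Gates of a Toffoli algebra\<close>

text \<open>
  Functions that agree on \<open>tuples A n\<close> are not distinguished here, so that unrestricted functions
  such as \<open>id\<close>, \<open>rev\<close> or \<open>transpose X Y\<close> can serve as gates.
\<close>

definition gates :: "'a set \<Rightarrow> 'a mapping set \<Rightarrow> nat \<Rightarrow> ('a list \<Rightarrow> 'a list) set" where
  "gates A T n = {f. (n, n, restrict f (tuples A n)) \<in> T}"

definition parallel :: "nat \<Rightarrow> ('a list \<Rightarrow> 'a list) \<Rightarrow> ('a list \<Rightarrow> 'a list) \<Rightarrow> 'a list \<Rightarrow> 'a list" where
  "parallel n f g xs = f (take n xs) @ g (drop n xs)"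

lemma gates_cong:
  assumes "f \<in> gates A T n" "\<And>xs. xs \<in> tuples A n \<Longrightarrow> f xs = g xs"
  shows "g \<in> gates A T n"
  using assms restrict_ext[of "tuples A n" f g] by (simp add: gates_def)

lemma gates_maps:
  assumes "toffoli_algebra A T" "f \<in> gates A T n"
  shows "1 \<le> n" "xs \<in> tuples A n \<Longrightarrow> f xs \<in> tuples A n"
  using assms by (auto simp: gates_def toffoli_algebra_def maps_def PiE_iff)

lemma take_drop_tuples:
  assumes "xs \<in> tuples A (n + m)"
  shows "take n xs \<in> tuples A n" "drop n xs \<in> tuples A m"
  using assms by (auto simp: tuples_def dest: in_set_takeD in_set_dropD)

lemma gates_comp:
  assumes T: "toffoli_algebra A T" and f: "f \<in> gates A T n" and g: "g \<in> gates A T n"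
  shows "f \<circ> g \<in> gates A T n"
proof -
  let ?r = "\<lambda>h. (n, n, restrict h (tuples A n))"
  have "1 \<le> n" using gates_maps[OF T f] by blast
  then have "compose_at A n (?r f) (?r g) \<in> T"
    using T f g
    by (simp add: toffoli_algebra_def gates_def arity_def coarity_def del: compose_at.simps)
  moreover have "compose_at A n (?r f) (?r g) = ?r (f \<circ> g)"
  proof -
    have "length (g xs) = n" "g xs \<in> tuples A n" "length xs = n" if "xs \<in> tuples A n" for xs
      using gates_maps(2)[OF T g that] that by (auto simp: tuples_def)
    then show ?thesis by (auto simp: Let_def fun_eq_iff restrict_def)
  qed
  ultimately show ?thesis by (simp add: gates_def)
qed

lemma gates_parallel:
  assumes T: "toffoli_algebra A T" and f: "f \<in> gates A T n" and g: "g \<in> gates A T m"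
  shows "parallel n f g \<in> gates A T (n + m)"
proof -
  let ?r = "\<lambda>n h. (n, n, restrict h (tuples A n))"
  have "oplus A (?r n f) (?r m g) \<in> T"
    using T f g by (simp add: toffoli_algebra_def gates_def del: oplus.simps)
  moreover have "oplus A (?r n f) (?r m g) = ?r (n + m) (parallel n f g)"
    by (auto simp: fun_eq_iff restrict_def parallel_def take_drop_tuples)
  ultimately show ?thesis by (simp add: gates_def)
qed

lemma gates_id:
  assumes T: "toffoli_algebra A T" and "1 \<le> n"
  shows "id \<in> gates A T n"
proof -
  have one: "id \<in> gates A T 1"
    using T by (simp add: gates_def toffoli_algebra_def identity_def id_def)
  show ?thesis
    using \<open>1 \<le> n\<close>
  proof (induction n rule: dec_induct)
    case base
    show ?case by (fact one)
  next
    case (step n)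
    have "parallel n id id \<in> gates A T (n + 1)"
      by (rule gates_parallel[OF T step.IH one])
    then have "id \<in> gates A T (n + 1)"
      by (rule gates_cong) (simp add: parallel_def)
    then show ?case by (simp only: Suc_eq_plus1)
  qed
qed

lemma gates_conjugate:
  assumes T: "toffoli_algebra A T" and g: "g \<in> gates A T n"
    and inv: "\<And>xs. xs \<in> tuples A n \<Longrightarrow> g (g xs) = xs"
    and X: "X \<in> tuples A n" and Y: "Y \<in> tuples A n" and XY: "transpose X Y \<in> gates A T n"
  shows "transpose (g X) (g Y) \<in> gates A T n"
proof (rule gates_cong)
  show "g \<circ> transpose X Y \<circ> g \<in> gates A T n"
    by (intro gates_comp T g XY)
  fix xs assume xs: "xs \<in> tuples A n"
  have eq: "g xs = Z \<longleftrightarrow> xs = g Z" if "Z \<in> tuples A n" for Z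
    using inv xs that by metis
  show "(g \<circ> transpose X Y \<circ> g) xs = transpose (g X) (g Y) xs"
    using inv[OF xs] eq[OF X] eq[OF Y] by (simp add: transpose_def)
qed

lemma gates_transpose_trans:
  assumes T: "toffoli_algebra A T" and "X \<noteq> Y" "X \<noteq> Z"
    and "transpose X Y \<in> gates A T n" "transpose Y Z \<in> gates A T n"
  shows "transpose X Z \<in> gates A T n"
proof -
  have "transpose X Z = transpose Y Z \<circ> transpose X Y \<circ> transpose Y Z"
    using assms(2,3) by (auto simp: fun_eq_iff transpose_def)
  then show ?thesis using assms by (simp add: gates_comp)
qed

lemma tuples_2E:
  assumes "xs \<in> tuples A 2"
  obtains a b where "xs = [a, b]" "a \<in> A" "b \<in> A"
  using assms by (auto simp: tuples_def length_Suc_conv numeral_2_eq_2)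

lemma gates_unary:
  assumes "T2 A c \<subseteq> T" "\<alpha> permutes A"
  shows "map \<alpha> \<in> gates A T 1"
  using assms unfolding gates_def T2_eq by (auto simp: unary_def)

text \<open>
  The operation \<open>\<tau>\<close> permutes inputs only; applied to the identity of \<open>A\<^sup>2\<close> it gives the exchange of
  wires as a gate, with which inputs and outputs can then be exchanged by composition.
\<close>

lemma gates_wire_swap:
  assumes T: "toffoli_algebra A T"
  shows "rev \<in> gates A T 2"
proof -
  have "tau A (2, 2, restrict id (tuples A 2)) \<in> T"
    using T gates_id[OF T, of 2] by (simp add: toffoli_algebra_def gates_def del: tau.simps)
  moreover have "(\<lambda>xs\<in>tuples A 2. restrict id (tuples A 2) (swap_first xs))
      = restrict rev (tuples A 2)"
  proof (rule restrict_ext)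
    fix xs assume "xs \<in> tuples A 2"
    then show "restrict id (tuples A 2) (swap_first xs) = rev xs"
      by (rule tuples_2E) (simp add: tuples_def)
  qed
  ultimately show ?thesis by (simp add: gates_def)
qed

lemma gates_controlled_transposition:
  assumes T: "T2 A c \<subseteq> T" and "x \<in> A" "y \<in> A"
  shows "transpose [c, x] [c, y] \<in> gates A T 2"
proof -
  let ?f = "\<lambda>xs. if \<forall>x\<in>set (butlast xs). x = c
                  then butlast xs @ [transpose x y (last xs)] else xs"
  have "TG A 2 (transpose x y) c \<in> T"
    using T permutes_swap_id[OF assms(2,3)] unfolding T2_eq by blast
  then have "?f \<in> gates A T 2"
    by (simp add: gates_def TG_def)
  then show ?thesis
  proof (rule gates_cong)
    fix xs assume "xs \<in> tuples A 2"
    then show "?f xs = transpose [c, x] [c, y] xs"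
      by (rule tuples_2E) (auto simp: transpose_def)
  qed
qed

section \<open>Transpositions of tuples\<close>

definition all_transpositions :: "'a set \<Rightarrow> 'a mapping set \<Rightarrow> nat \<Rightarrow> bool" where
  "all_transpositions A T n \<longleftrightarrow>
     (\<forall>X\<in>tuples A n. \<forall>Y\<in>tuples A n. X \<noteq> Y \<longrightarrow> transpose X Y \<in> gates A T n)"

lemma all_transpositionsD:
  "all_transpositions A T n \<Longrightarrow> X \<in> tuples A n \<Longrightarrow> Y \<in> tuples A n \<Longrightarrow> X \<noteq> Y \<Longrightarrow>
     transpose X Y \<in> gates A T n"
  by (simp add: all_transpositions_def)

text \<open>
  Unary permutations of the first coordinate carry the row of \<open>c\<close> to any other row, the exchange of
  wires carries rows to columns, and a row step followed by a column step reaches every pair.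
\<close>

lemma transpositions_of_pairs:
  assumes T: "toffoli_algebra A T" and T2: "T2 A c \<subseteq> T" and c: "c \<in> A"
  shows "all_transpositions A T 2"
  unfolding all_transpositions_def
proof (intro ballI impI)
  fix X Y assume X: "X \<in> tuples A 2" and Y: "Y \<in> tuples A 2" and XY: "X \<noteq> Y"
  have row: "transpose [z, x] [z, y] \<in> gates A T 2" if "x \<in> A" "y \<in> A" "z \<in> A" for x y z
  proof -
    let ?g = "parallel 1 (map (transpose c z)) id"
    have "?g \<in> gates A T (1 + 1)"
      by (intro gates_parallel T gates_unary[OF T2] gates_id permutes_swap_id c that) simp
    then have g: "?g \<in> gates A T 2" by (simp add: numeral_2_eq_2)
    have "?g (?g xs) = xs" if "xs \<in> tuples A 2" for xs
      using that by (rule tuples_2E) (simp add: parallel_def)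
    from gates_conjugate[OF T g this _ _ gates_controlled_transposition[OF T2 that(1,2)]]
    show ?thesis
      using c that by (simp add: parallel_def tuples_def)
  qed
  have col: "transpose [x, z] [y, z] \<in> gates A T 2" if "x \<in> A" "y \<in> A" "z \<in> A" for x y z
    using gates_conjugate[OF T gates_wire_swap[OF T] _ _ _ row[OF that]] that
    by (simp add: tuples_def)
  obtain x y where X': "X = [x, y]" "x \<in> A" "y \<in> A" using X by (rule tuples_2E)
  obtain z w where Y': "Y = [z, w]" "z \<in> A" "w \<in> A" using Y by (rule tuples_2E)
  show "transpose X Y \<in> gates A T 2"
  proof (cases "y = w")
    case True
    then show ?thesis using col X' Y' by simp
  next
    case False
    have "transpose X [x, w] \<in> gates A T 2" "transpose [x, w] Y \<in> gates A T 2"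
      using row[of y w x] col[of x z w] X' Y' by simp_all
    then show ?thesis
      using False X' by (intro gates_transpose_trans[OF T _ XY]) simp_all
  qed
qed

lemma tuples_snocE:
  assumes "xs \<in> tuples A (Suc n)"
  obtains ys a where "xs = ys @ [a]" "ys \<in> tuples A n" "a \<in> A"
proof (cases xs rule: rev_cases)
  case Nil
  then show ?thesis using assms by (simp add: tuples_def)
next
  case (snoc ys a)
  then show ?thesis using assms by (intro that) (auto simp: tuples_def)
qed

lemma snoc_in_tuples [simp]:
  "xs @ [a] \<in> tuples A (Suc n) \<longleftrightarrow> xs \<in> tuples A n \<and> a \<in> A"
  by (auto simp: tuples_def)

lemma snoc2_in_tuples [simp]:
  "xs @ [a, b] \<in> tuples A (Suc (Suc n)) \<longleftrightarrow> xs \<in> tuples A n \<and> a \<in> A \<and> b \<in> A"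
  by (auto simp: tuples_def)

lemma parallel_append [simp]:
  "xs \<in> tuples A n \<Longrightarrow> parallel n f g (xs @ ys) = f xs @ g ys"
  by (simp add: parallel_def tuples_def)

text \<open>
  The gate \<open>?a\<close> moves a tuple only if its first coordinates are \<open>p @ [x]\<close> or \<open>q @ [y]\<close>, and \<open>?b\<close> only
  if its last two are \<open>[x, u]\<close> or \<open>[z, v]\<close>. As \<open>x, y, z\<close> are distinct, both happen only at
  \<open>p @ [x, u]\<close>.
\<close>

lemma three_cycle_of_tuples:
  assumes T: "toffoli_algebra A T"
    and IH: "all_transpositions A T (Suc m)"
    and pairs: "all_transpositions A T 2"
    and m: "1 \<le> m" and p: "p \<in> tuples A m" and q: "q \<in> tuples A m"
    and A: "x \<in> A" "y \<in> A" "z \<in> A" "u \<in> A" "v \<in> A"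
    and d: "x \<noteq> y" "y \<noteq> z" "x \<noteq> z"
  shows "has_three_cycle (gates A T (Suc (Suc m))) (p @ [x, u]) (q @ [y, u]) (p @ [z, v])"
proof -
  let ?\<Omega> = "tuples A (Suc (Suc m))"
  let ?a = "parallel (Suc m) (transpose (p @ [x]) (q @ [y])) id"
  let ?b = "parallel m id (transpose [x, u] [z, v])"
  let ?P = "p @ [x, u]"
  have "?a \<in> gates A T (Suc m + 1)"
    using p q A d by (intro gates_parallel T all_transpositionsD[OF IH] gates_id) auto
  then have a: "?a \<in> gates A T (Suc (Suc m))" by simp
  have "?b \<in> gates A T (m + 2)"
    using A d m by (intro gates_parallel T all_transpositionsD[OF pairs] gates_id) (auto simp: tuples_def)
  then have b: "?b \<in> gates A T (Suc (Suc m))" by simp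
  have a_app: "?a (r @ [s, t]) = transpose (p @ [x]) (q @ [y]) (r @ [s]) @ [t]"
    if "r \<in> tuples A m" "s \<in> A" for r s t
    using parallel_append[of "r @ [s]" A "Suc m" _ _ "[t]"] that by simp
  have b_app: "?b (r @ [s, t]) = r @ transpose [x, u] [z, v] [s, t]"
    if "r \<in> tuples A m" for r s t
    using that by simp
  have split: "\<exists>r s t. xs = r @ [s, t] \<and> r \<in> tuples A m \<and> s \<in> A \<and> t \<in> A" if xs: "xs \<in> ?\<Omega>" for xs
  proof -
    obtain ys t where "xs = ys @ [t]" "ys \<in> tuples A (Suc m)" "t \<in> A"
      using xs by (rule tuples_snocE)
    moreover from this obtain r s where "ys = r @ [s]" "r \<in> tuples A m" "s \<in> A"
      using tuples_snocE by blast
    ultimately show ?thesis by auto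
  qed
  have aP: "?a ?P = q @ [y, u]" and bP: "?b ?P = p @ [z, v]"
    using p A by (simp_all add: a_app b_app)
  have "?a (?b (?a (?b xs))) = transpose ?P (?a ?P) (transpose (?a ?P) (?b ?P) xs)"
    if xs: "xs \<in> ?\<Omega>" for xs
  proof (rule commutator_three_cycle[where \<Omega> = ?\<Omega>])
    fix xs assume xs: "xs \<in> ?\<Omega>"
    then obtain r s t where r: "xs = r @ [s, t]" "r \<in> tuples A m" "s \<in> A" "t \<in> A"
      using split by blast
    have "?a (?a xs) = xs"
      using r p q A by (auto simp: a_app transpose_def)
    then show "?a xs \<in> ?\<Omega> \<and> ?a (?a xs) = xs"
      using gates_maps(2)[OF T a xs] by blast
    have "?b (?b xs) = xs"
      using r by (auto simp: b_app transpose_def)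
    then show "?b xs \<in> ?\<Omega> \<and> ?b (?b xs) = xs"
      using gates_maps(2)[OF T b xs] by blast
    assume "?a xs \<noteq> xs" "?b xs \<noteq> xs"
    then show "xs = ?P"
      using r d by (auto simp: a_app b_app transpose_def split: if_splits)
  next
    show "?P \<in> ?\<Omega>" "?a ?P \<noteq> ?P" "?b ?P \<noteq> ?P" "xs \<in> ?\<Omega>"
      using p A d xs unfolding aP bP by simp_all
  qed
  note commutator = this[unfolded aP bP]
  have "transpose ?P (q @ [y, u]) \<circ> transpose (q @ [y, u]) (p @ [z, v])
      \<in> gates A T (Suc (Suc m))"
    by (rule gates_cong[OF gates_comp[OF T gates_comp[OF T a b] gates_comp[OF T a b]]])
      (simp only: comp_apply commutator)
  then show ?thesis
    using d by (simp add: has_three_cycle_def)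
qed

text \<open>
  The parity argument. For \<open>U \<subseteq> A\<close>, the map \<open>t U\<close> in the proof exchanges \<open>P @ [a]\<close> and \<open>Q @ [a]\<close>
  for each \<open>a \<in> U\<close>, so it is a product of \<open>|U|\<close> transpositions. Since products of two transpositions
  are gates, \<open>t U\<close> is a gate if \<open>|U|\<close> is even and becomes one after composition with any
  transposition if \<open>|U|\<close> is odd. But \<open>t A\<close> itself is the transposition of \<open>P\<close> and \<open>Q\<close> in parallel
  with the identity, hence a gate; for odd \<open>|A|\<close> it can be cancelled.
\<close>

lemma transpositions_step:
  assumes T: "toffoli_algebra A T"
    and IH: "all_transpositions A T (Suc m)"
    and pairs: "all_transpositions A T 2"
    and fin: "finite A" and card: "odd (card A)" "3 \<le> card A" and m: "1 \<le> m"
  shows "all_transpositions A T (Suc (Suc m))"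
  unfolding all_transpositions_def
proof (intro ballI impI)
  fix X Y
  assume X: "X \<in> tuples A (Suc (Suc m))" and Y: "Y \<in> tuples A (Suc (Suc m))" and XY: "X \<noteq> Y"
  let ?\<Omega> = "tuples A (Suc (Suc m))"
  let ?G = "gates A T (Suc (Suc m))"
  have comp: "\<forall>f\<in>?G. \<forall>g\<in>?G. f \<circ> g \<in> ?G" using gates_comp[OF T] by blast
  have id: "id \<in> ?G" using gates_id[OF T] by simp
  note cyc = three_cycle_of_tuples[OF T IH pairs m]
  have third: "\<exists>z\<in>A. z \<noteq> x \<and> z \<noteq> y" for x y
  proof -
    have "card {x, y} < card A" using card by (simp add: card_insert_if)
    then have "\<not> A \<subseteq> {x, y}" using card_mono[of "{x, y}" A] by auto
    then show ?thesis by blast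
  qed
  have linked: "three_linked ?G V W" if V: "V \<in> ?\<Omega>" and W: "W \<in> ?\<Omega>" and VW: "V \<noteq> W" for V W
  proof -
    obtain V' u where V': "V = V' @ [u]" "V' \<in> tuples A (Suc m)" "u \<in> A"
      using V by (rule tuples_snocE)
    obtain p x where p: "V' = p @ [x]" "p \<in> tuples A m" "x \<in> A"
      using V'(2) by (rule tuples_snocE)
    obtain W' v where W': "W = W' @ [v]" "W' \<in> tuples A (Suc m)" "v \<in> A"
      using W by (rule tuples_snocE)
    obtain q y where q: "W' = q @ [y]" "q \<in> tuples A m" "y \<in> A"
      using W'(2) by (rule tuples_snocE)
    \<comment> \<open>a link must change the next-to-last coordinate, so a detour through
      a third value \<open>z\<close> covers the case \<open>x = y\<close>\<close>
    obtain z where z: "z \<in> A" "z \<noteq> x" "z \<noteq> y" using third by blast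
    obtain w where w: "w \<in> A" "w \<noteq> x" "w \<noteq> z" using third by blast
    have "has_three_cycle ?G (p @ [x, u]) (p @ [w, u]) (p @ [z, v])"
      using z w V'(3) W'(3) by (intro cyc p(2,3)) auto
    then have "has_three_cycle ?G (p @ [x, u]) (p @ [z, v]) (p @ [w, u])"
      by (rule three_cycle_rotate[OF three_cycle_rotate[OF three_cycle_reverse[OF comp]]])
    then have 1: "three_linked ?G V (p @ [z, v])"
      using V'(1) p(1) unfolding three_linked_def by auto
    obtain w where w: "w \<in> A" "w \<noteq> z" "w \<noteq> y" using third by blast
    have "has_three_cycle ?G (p @ [z, v]) (q @ [y, v]) (p @ [w, v])"
      using z w W'(3) by (intro cyc p(2) q(2,3)) auto
    then have 2: "three_linked ?G (p @ [z, v]) W"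
      using W'(1) q(1) unfolding three_linked_def by auto
    show ?thesis by (rule three_linked_trans[OF comp 1 2 VW])
  qed
  have two: "transpose V W \<circ> transpose V' W' \<in> ?G"
    if "V \<in> ?\<Omega>" "W \<in> ?\<Omega>" "V' \<in> ?\<Omega>" "W' \<in> ?\<Omega>" "V \<noteq> W" "V' \<noteq> W'" for V W V' W'
    using linked by (intro pair_of_transpositions[OF comp id _ that]) blast
  obtain u where u: "u \<in> A" using third by blast
  obtain u' where u': "u' \<in> A" "u' \<noteq> u" using third by blast
  define P where "P = replicate (Suc m) u"
  define Q where "Q = replicate (Suc m) u'"
  have P: "P \<in> tuples A (Suc m)" and Q: "Q \<in> tuples A (Suc m)" and PQ: "P \<noteq> Q"
    using u u' by (auto simp: P_def Q_def tuples_def)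
  define t where
    "t U xs = (if last xs \<in> U then transpose P Q (butlast xs) @ [last xs] else xs)" for U xs
  have parity: "(if even (card U) then t U \<in> ?G
      else \<forall>V W. V \<in> ?\<Omega> \<longrightarrow> W \<in> ?\<Omega> \<longrightarrow> V \<noteq> W \<longrightarrow> transpose V W \<circ> t U \<in> ?G)"
    if "finite U" "U \<subseteq> A" for U
    using that
  proof (induction U rule: finite_induct)
    case empty
    have "t {} = id" by (auto simp: t_def fun_eq_iff)
    then show ?case using id by simp
  next
    case (insert a U)
    let ?s = "transpose (P @ [a]) (Q @ [a])"
    have s: "P @ [a] \<in> ?\<Omega>" "Q @ [a] \<in> ?\<Omega>" "P @ [a] \<noteq> Q @ [a]"
      using P Q PQ insert.prems by auto
    have t_insert: "(?s \<circ> t U) xs = t (insert a U) xs" if xs: "xs \<in> ?\<Omega>" for xs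
    proof -
      obtain ys b where "xs = ys @ [b]" using xs by (rule tuples_snocE)
      then show ?thesis using insert.hyps by (auto simp: t_def transpose_def)
    qed
    show ?case
    proof (cases "even (card U)")
      case True
      have "transpose V W \<circ> t (insert a U) \<in> ?G" if "V \<in> ?\<Omega>" "W \<in> ?\<Omega>" "V \<noteq> W" for V W
      proof -
        have "(transpose V W \<circ> ?s) \<circ> t U \<in> ?G"
          using comp two[OF that(1,2) s(1,2) that(3) s(3)] insert True by auto
        then show ?thesis
          by (rule gates_cong) (use t_insert in simp)
      qed
      then show ?thesis using True insert.hyps by simp
    next
      case False
      have "?s \<circ> t U \<in> ?G" using insert s False by auto
      then have "t (insert a U) \<in> ?G" by (rule gates_cong) (rule t_insert)
      then show ?thesis using False insert.hyps by simp
    qed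
  qed
  have "parallel (Suc m) (transpose P Q) id \<in> gates A T (Suc m + 1)"
    by (intro gates_parallel T all_transpositionsD[OF IH] P Q PQ gates_id) simp
  then have "parallel (Suc m) (transpose P Q) id \<in> ?G" by simp
  then have tA: "t A \<in> ?G"
  proof (rule gates_cong)
    fix xs assume "xs \<in> ?\<Omega>"
    then obtain ys b where "xs = ys @ [b]" "ys \<in> tuples A (Suc m)" "b \<in> A" by (rule tuples_snocE)
    then show "parallel (Suc m) (transpose P Q) id xs = t A xs" by (simp add: t_def)
  qed
  have "transpose X Y \<circ> t A \<circ> t A \<in> ?G"
    using parity[OF fin order_refl] card(1) X Y XY comp tA by simp
  moreover have "t A (t A xs) = xs" if "xs \<in> ?\<Omega>" for xs
    using that by (rule tuples_snocE) (simp add: t_def)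
  ultimately show "transpose X Y \<in> ?G" by (elim gates_cong) simp
qed

lemma transpositions_of_tuples:
  assumes T: "toffoli_algebra A T" and T2: "T2 A c \<subseteq> T" and c: "c \<in> A"
    and fin: "finite A" and card: "odd (card A)" "3 \<le> card A" and "2 \<le> n"
  shows "all_transpositions A T n"
  using \<open>2 \<le> n\<close>
proof (induction n rule: dec_induct)
  case base
  show ?case by (rule transpositions_of_pairs[OF T T2 c])
next
  case (step n)
  then obtain m where n: "n = Suc m" "1 \<le> m" by (cases n) auto
  show ?case
    using transpositions_step[OF T _ transpositions_of_pairs[OF T T2 c] fin card n(2)] step.IH
    by (simp add: n(1))
qed

section \<open>Bijections of tuples\<close>

lemma finite_tuples: "finite A \<Longrightarrow> finite (tuples A n)"
  unfolding tuples_def by (rule finite_lists_length_eq)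

lemma permutations_of_tuples:
  assumes T: "toffoli_algebra A T" and T2: "T2 A c \<subseteq> T" and c: "c \<in> A"
    and fin: "finite A" and odd: "odd (card A)" and n: "1 \<le> n" and p: "p permutes tuples A n"
  shows "p \<in> gates A T n"
proof (rule transpositions_generate[OF finite_tuples[OF fin] _ gates_id[OF T n] _ p])
  show "\<forall>f\<in>gates A T n. \<forall>g\<in>gates A T n. f \<circ> g \<in> gates A T n"
    using gates_comp[OF T] by blast
  fix X Y assume X: "X \<in> tuples A n" and Y: "Y \<in> tuples A n" and XY: "X \<noteq> Y"
  show "transpose X Y \<in> gates A T n"
  proof (cases "n = 1")
    case True
    obtain x y where x: "X = [x]" "x \<in> A" and y: "Y = [y]" "y \<in> A"
      using X Y True by (auto simp: tuples_def length_Suc_conv)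
    have "map (transpose x y) \<in> gates A T 1"
      by (rule gates_unary[OF T2 permutes_swap_id[OF x(2) y(2)]])
    then have "transpose X Y \<in> gates A T 1"
      by (rule gates_cong) (auto simp: x y tuples_def length_Suc_conv transpose_def split: if_splits)
    then show ?thesis using True by simp
  next
    case False
    have "card A \<noteq> 1"
    proof
      assume "card A = 1"
      then obtain a where "A = {a}" by (rule card_1_singletonE)
      then have "X = replicate n a" "Y = replicate n a"
        using X Y by (auto simp: tuples_def intro!: replicate_eqI)
      then show False using XY by simp
    qed
    moreover have "card A \<noteq> 2" using odd by auto
    moreover have "card A \<noteq> 0" using odd by (intro notI) simp
    ultimately have "3 \<le> card A" by linarith
    then show ?thesis
      using transpositions_of_tuples[OF T T2 c fin odd, of n] False n X Y XY
      by (simp add: all_transpositions_def)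
  qed
qed

theorem theorem5p11:
  fixes A :: "'a set" and c :: 'a
  assumes "finite A" and "odd (card A)" and "c \<in> A"
  shows "bijections A \<subseteq> toffoli_closure A (T2 A c)"
proof
  fix b assume "b \<in> bijections A"
  then obtain n f where b: "b = (n, n, f)" and n: "1 \<le> n" and ext: "f \<in> extensional (tuples A n)"
    and bij: "bij_betw f (tuples A n) (tuples A n)"
    by (auto simp: bijections_def)
  let ?T = "toffoli_closure A (T2 A c)"
  let ?p = "\<lambda>xs. if xs \<in> tuples A n then f xs else xs"
  note closure = toffoli_algebra_closure[OF T2_subset_maps[OF assms(3)]]
  have "?p permutes tuples A n"
    using bij by (intro bij_imp_permutes) (auto cong: bij_betw_cong)
  then have "?p \<in> gates A ?T n"
    by (rule permutations_of_tuples[OF closure(1,2) assms(3,1,2) n])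
  moreover have "restrict ?p (tuples A n) = f"
    using ext by (auto simp: restrict_def extensional_def fun_eq_iff)
  ultimately show "b \<in> ?T"
    by (simp add: b gates_def)
qed

end
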